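(* Suppose the feasibility assumption and the regularity assumption stated in the context hold and let $(\bar x,\bar v_i)\in\mathcal{S}_i$ be a nondegenerate stationary point. Further assume that in the basic Newton line search method described in the context there exists $\beta_{\min}\in(0,1]$ such that $\beta^j\ge\beta_{\min}$ for all $j$. Then a subproblem solver implementing this method with warm start satisfies the consistent-output property at $(\bar x,\bar v_i)$. Namely, there exists $r_3>0$ such that for all $(x,v_i)\in B((\bar x,\bar v_i),r_3)\cap\mathcal{S}_i$ and all $x^+=x+p$ with $\|p\|\le r_3$ the following holds: if the method is initialized from the inputs $v_i^0=v_i$ and $x^+$, it converges to a limit point $v_i^+$ (a stationary point, $F_i(v_i^+;x^+)=0$) such that $(x^+,v_i^+)\in B((\bar x,\bar v_i),r_2)$, where $r_2$ is the radius defined in the context.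
   Context: Two-stage problem: the first stage is $\min_{x\in\mathbb{R}^{n_0}} f_0(x)+\sum_{i=1}^N\hat f_i(x)$ subject to $c_0(x)\le 0$; the $i$-th second-stage problem (subproblem) parameterized by $x$ is $\min_{y_i\in\mathbb{R}^{n_i}} f_i(y_i;x)$ subject to $c_i(y_i;x)\le 0$, with $f_i:\mathbb{R}^{n_i}\times\mathbb{R}^{n_0}\to\mathbb{R}$ and $c_i:\mathbb{R}^{n_i}\times\mathbb{R}^{n_0}\to\mathbb{R}^{m_i}$, not necessarily convex. Fix a smoothing parameter $\mu>0$. The smoothed (barrier) subproblem is $$\min_{y_i,s_i,\tilde x_i} f_i(y_i;\tilde x_i)-\mu\sum_j\ln(s_{ij})\quad\text{s.t.}\quad c_i(y_i;\tilde x_i)+s_i=0\ [\lambda_i],\quad \tilde x_i-x=0\ [\eta_i],$$ with multipliers in brackets. Let $v_i=(y_i,\tilde x_i,s_i,\lambda_i,\eta_i)\in\mathbb{R}^{n_{v_i}}$, $\mathcal{L}_i=f_i(y_i;\tilde x_i)+(c_i(y_i;\tilde x_i)+s_i)^T\lambda_i+(\tilde x_i-x)^T\eta_i$, and $$F_i(v_i;x)=\big(\nabla_{y_i}\mathcal{L}_i,\ \nabla_{\tilde x_i}\mathcal{L}_i,\ s_i\circ\lambda_i-\mu e,\ c_i(y_i;\tilde x_i)+s_i,\ \tilde x_i-x\big),$$ where $\circ$ is the componentwise product and $e$ the all-ones vector. Let $\mathcal{S}_i=\{(x,v_i)\in\mathbb{R}^{n_0}\times\mathbb{R}^{n_{v_i}}:F_i(v_i;x)=0\}$.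 A point $(x,v_i)\in\mathcal{S}_i$ is a nondegenerate stationary point if $\nabla_{v_i}F_i(v_i;x)$ (the transpose of the Jacobian of $F_i(\cdot;x)$) is nonsingular. A solution map is a continuous map $v_i^*:U\to\mathbb{R}^{n_{v_i}}$ on a neighborhood $U\subset\mathbb{R}^{n_0}$ with $(x,v_i^*(x))\in\mathcal{S}_i$ for all $x\in U$; it has reference point $(\bar x,\bar v_i)$ if $v_i^*(\bar x)=\bar v_i$. $B(\cdot,r)$ is the open Euclidean ball. For each nondegenerate $(\bar x,\bar v_i)\in\mathcal{S}_i$ there are radii $r_1\ge r_2>0$ (fixed once and for all) such that there is a unique $C^1$ solution map $v_i^*(\cdot;(\bar x,\bar v_i))$ on $B(\bar x,r_1)$ with reference point $(\bar x,\bar v_i)$, and its graph is the zero level set of $F_i$ inside $B((\bar x,\bar v_i),r_2)$. Basic Newton line search method: given an initial iterate $v_i^0$ and a first-stage variable $x$, for $j=0,1,2,\dots$ compute $\Delta v_i^j$ from $\nabla_{v_i}F_i(v_i^j;x)^T\Delta v_i^j=-F_i(v_i^j;x)$, choose a step size $\beta^j\in(0,1]$ by a line search, and set $v_i^{j+1}=v_i^j+\beta^j\Delta v_i^j$. Warm start means that at a new input the method starts from the most recently computed solution. Consistent-output property at $(\bar x,\bar v_i)$: there exists $r_3>0$ such that, if $v_i^k$ is the stationary point computed by the solver for $x^k$ and $(x^k,v_i^k)\in\mathcal{S}_i\cap B((\bar x,\bar v_i),r_3)$, then when the solver is started from $v_i^k$ for input $x^+=x^k+p$ with $\|p\|\le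 r_3$, the stationary point $v_i^+$ it computes satisfies $(x^+,v_i^+)\in B((\bar x,\bar v_i),r_2)$. Feasibility assumption: for any $x$ sent to the subproblems by the first-stage problem, the subproblem parameterized by $x$ is feasible and the subproblem solver always returns a KKT point of the smoothed subproblem. Regularity assumption: $f_0,c_0$ are $C^1$ with locally Lipschitz continuous first derivatives. If objective smoothing is used (second-stage value = optimal barrier objective value), $f_i(\cdot;\cdot)$ and $c_i(\cdot;\cdot)$ are $C^2$ with locally Lipschitz continuous second derivatives; if solution smoothing is used (second-stage value = $f_i$ evaluated at the barrier solution), they are $C^3$. *)

theory Defs
  imports "HOL-Analysis.Analysis"
begin

section \<open>Smoothness classes\<close>

text \<open>The derivative as a map into the normed space of bounded linear maps, so that it can be
  differentiated again. It is meaningful only where the function is differentiable.\<close>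

definition blinfun_deriv ::
    "('a::real_normed_vector \<Rightarrow> 'b::real_normed_vector) \<Rightarrow> 'a \<Rightarrow> 'a \<Rightarrow>\<^sub>L 'b" where
  "blinfun_deriv g z = Blinfun (frechet_derivative g (at z))"

definition C1_on ::
    "'a::real_normed_vector set \<Rightarrow> ('a \<Rightarrow> 'b::real_normed_vector) \<Rightarrow> bool" where
  "C1_on U g \<longleftrightarrow> (\<forall>z\<in>U. g differentiable (at z)) \<and> continuous_on U (blinfun_deriv g)"

definition locally_lipschitz :: "('a::metric_space \<Rightarrow> 'b::metric_space) \<Rightarrow> bool" where
  "locally_lipschitz g \<longleftrightarrow> (\<forall>z. \<exists>e>0. \<exists>L. L-lipschitz_on (ball z e) g)"

definition C1_lip :: "('a::real_normed_vector \<Rightarrow> 'b::real_normed_vector) \<Rightarrow> bool" where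
  "C1_lip g \<longleftrightarrow> C1_on UNIV g \<and> locally_lipschitz (blinfun_deriv g)"

definition C2_lip :: "('a::real_normed_vector \<Rightarrow> 'b::real_normed_vector) \<Rightarrow> bool" where
  "C2_lip g \<longleftrightarrow> C1_on UNIV g \<and> C1_on UNIV (blinfun_deriv g)
     \<and> locally_lipschitz (blinfun_deriv (blinfun_deriv g))"

definition C3 :: "('a::real_normed_vector \<Rightarrow> 'b::real_normed_vector) \<Rightarrow> bool" where
  "C3 g \<longleftrightarrow> C1_on UNIV g \<and> C1_on UNIV (blinfun_deriv g)
     \<and> C1_on UNIV (blinfun_deriv (blinfun_deriv g))"

datatype smoothing = Objective_Smoothing | Solution_Smoothing

definition regularity_assumption ::
    "smoothing \<Rightarrow> (real^'n0 \<Rightarrow> real) \<Rightarrow> (real^'n0 \<Rightarrow> real^'m0)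
     \<Rightarrow> ((real^'n) \<times> (real^'n0) \<Rightarrow> real) \<Rightarrow> ((real^'n) \<times> (real^'n0) \<Rightarrow> real^'m) \<Rightarrow> bool" where
  "regularity_assumption sm f\<^sub>0 c\<^sub>0 f c \<longleftrightarrow> C1_lip f\<^sub>0 \<and> C1_lip c\<^sub>0 \<and>
     (case sm of
        Objective_Smoothing \<Rightarrow> C2_lip f \<and> C2_lip c
      | Solution_Smoothing \<Rightarrow> C3 f \<and> C3 c)"


section \<open>The smoothed subproblem\<close>

text \<open>Vectors \<open>(y, xt, s, lam, eta)\<close>; \<open>xt\<close> is the local copy of the first-stage variable \<open>x\<close>.
  The norm of the product type is the Euclidean one.\<close>

type_synonym ('n, 'n0, 'm) pdvec =
  "(real^'n) \<times> (real^'n0) \<times> (real^'m) \<times> (real^'m) \<times> (real^'n0)"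

definition gradient :: "(real^'k \<Rightarrow> real) \<Rightarrow> real^'k \<Rightarrow> real^'k" where
  "gradient g z = (\<chi> i. frechet_derivative g (at z) (axis i 1))"

definition lagrangian ::
    "((real^'n) \<times> (real^'n0) \<Rightarrow> real) \<Rightarrow> ((real^'n) \<times> (real^'n0) \<Rightarrow> real^'m)
     \<Rightarrow> real^'n0 \<Rightarrow> ('n, 'n0, 'm) pdvec \<Rightarrow> real" where
  "lagrangian f c x = (\<lambda>(y, xt, s, lam, eta).
     f (y, xt) + (c (y, xt) + s) \<bullet> lam + (xt - x) \<bullet> eta)"

definition residual ::
    "real \<Rightarrow> ((real^'n) \<times> (real^'n0) \<Rightarrow> real) \<Rightarrow> ((real^'n) \<times> (real^'n0) \<Rightarrow> real^'m)
     \<Rightarrow> real^'n0 \<Rightarrow> ('n, 'n0, 'm) pdvec \<Rightarrow> ('n, 'n0, 'm) pdvec" where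
  "residual \<mu> f c x = (\<lambda>(y, xt, s, lam, eta).
     (gradient (\<lambda>y'. lagrangian f c x (y', xt, s, lam, eta)) y,
      gradient (\<lambda>xt'. lagrangian f c x (y, xt', s, lam, eta)) xt,
      (\<chi> j. s $ j * lam $ j - \<mu>),
      c (y, xt) + s,
      xt - x))"

definition stationary_set ::
    "real \<Rightarrow> ((real^'n) \<times> (real^'n0) \<Rightarrow> real) \<Rightarrow> ((real^'n) \<times> (real^'n0) \<Rightarrow> real^'m)
     \<Rightarrow> ((real^'n0) \<times> ('n, 'n0, 'm) pdvec) set" where
  "stationary_set \<mu> f c = {(x, v). residual \<mu> f c x v = 0}"

text \<open>The Jacobian of the residual in \<open>v\<close>, as a linear map; in matrix notation it is the
  transpose of the gradient matrix of the residual, and one is nonsingular iff the other is.\<close>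

definition newton_map ::
    "real \<Rightarrow> ((real^'n) \<times> (real^'n0) \<Rightarrow> real) \<Rightarrow> ((real^'n) \<times> (real^'n0) \<Rightarrow> real^'m)
     \<Rightarrow> real^'n0 \<Rightarrow> ('n, 'n0, 'm) pdvec \<Rightarrow> ('n, 'n0, 'm) pdvec \<Rightarrow> ('n, 'n0, 'm) pdvec" where
  "newton_map \<mu> f c x v = frechet_derivative (residual \<mu> f c x) (at v)"

definition nondegenerate_stationary ::
    "real \<Rightarrow> ((real^'n) \<times> (real^'n0) \<Rightarrow> real) \<Rightarrow> ((real^'n) \<times> (real^'n0) \<Rightarrow> real^'m)
     \<Rightarrow> real^'n0 \<Rightarrow> ('n, 'n0, 'm) pdvec \<Rightarrow> bool" where
  "nondegenerate_stationary \<mu> f c x v \<longleftrightarrow>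
     (x, v) \<in> stationary_set \<mu> f c \<and> bij (newton_map \<mu> f c x v)"

definition barrier_lagrangian ::
    "real \<Rightarrow> ((real^'n) \<times> (real^'n0) \<Rightarrow> real) \<Rightarrow> ((real^'n) \<times> (real^'n0) \<Rightarrow> real^'m)
     \<Rightarrow> real^'n0 \<Rightarrow> ('n, 'n0, 'm) pdvec \<Rightarrow> real" where
  "barrier_lagrangian \<mu> f c x = (\<lambda>(y, xt, s, lam, eta).
     f (y, xt) - \<mu> * (\<Sum>j\<in>UNIV. ln (s $ j)) + (c (y, xt) + s) \<bullet> lam + (xt - x) \<bullet> eta)"

text \<open>Unlike membership in the stationary set, being a KKT point of the smoothed subproblem
  requires \<open>s\<close> to lie in the domain of the barrier.\<close>

definition kkt_point ::
    "real \<Rightarrow> ((real^'n) \<times> (real^'n0) \<Rightarrow> real) \<Rightarrow> ((real^'n) \<times> (real^'n0) \<Rightarrow> real^'m)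
     \<Rightarrow> real^'n0 \<Rightarrow> ('n, 'n0, 'm) pdvec \<Rightarrow> bool" where
  "kkt_point \<mu> f c x = (\<lambda>(y, xt, s, lam, eta).
     (\<forall>j. s $ j > 0) \<and>
     gradient (\<lambda>y'. barrier_lagrangian \<mu> f c x (y', xt, s, lam, eta)) y = 0 \<and>
     gradient (\<lambda>xt'. barrier_lagrangian \<mu> f c x (y, xt', s, lam, eta)) xt = 0 \<and>
     gradient (\<lambda>s'. barrier_lagrangian \<mu> f c x (y, xt, s', lam, eta)) s = 0 \<and>
     c (y, xt) + s = 0 \<and> xt - x = 0)"


section \<open>Solution maps\<close>

definition solution_map ::
    "real \<Rightarrow> ((real^'n) \<times> (real^'n0) \<Rightarrow> real) \<Rightarrow> ((real^'n) \<times> (real^'n0) \<Rightarrow> real^'m)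
     \<Rightarrow> (real^'n0) set \<Rightarrow> (real^'n0 \<Rightarrow> ('n, 'n0, 'm) pdvec) \<Rightarrow> bool" where
  "solution_map \<mu> f c U w \<longleftrightarrow>
     continuous_on U w \<and> (\<forall>x\<in>U. (x, w x) \<in> stationary_set \<mu> f c)"

text \<open>\<open>r1\<close> and \<open>r2\<close> are radii as provided by the implicit function theorem. Maps on the ball
  are total functions here, so uniqueness is equality on the ball.\<close>

definition solution_map_radii ::
    "real \<Rightarrow> ((real^'n) \<times> (real^'n0) \<Rightarrow> real) \<Rightarrow> ((real^'n) \<times> (real^'n0) \<Rightarrow> real^'m)
     \<Rightarrow> real^'n0 \<Rightarrow> ('n, 'n0, 'm) pdvec \<Rightarrow> real \<Rightarrow> real \<Rightarrow> bool" where
  "solution_map_radii \<mu> f c xb vb r1 r2 \<longleftrightarrow> r1 \<ge> r2 \<and> r2 > 0 \<and>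
     (\<exists>w. solution_map \<mu> f c (ball xb r1) w \<and> C1_on (ball xb r1) w \<and> w xb = vb \<and>
        (\<forall>w'. solution_map \<mu> f c (ball xb r1) w' \<and> C1_on (ball xb r1) w' \<and> w' xb = vb
           \<longrightarrow> (\<forall>x\<in>ball xb r1. w' x = w x)) \<and>
        {(x, w x) |x. x \<in> ball xb r1} \<inter> ball (xb, vb) r2
          = stationary_set \<mu> f c \<inter> ball (xb, vb) r2)"


section \<open>The basic Newton line search method\<close>

text \<open>\<open>v\<close> is the sequence of iterates produced from \<open>v0\<close> for the first-stage variable \<open>x\<close> with
  step sizes \<open>\<beta>\<close>. All Newton systems are required to be nonsingular, so there is at most
  one such sequence, and its existence means that the method does not break down.\<close>

definition newton_run ::
    "real \<Rightarrow> ((real^'n) \<times> (real^'n0) \<Rightarrow> real) \<Rightarrow> ((real^'n) \<times> (real^'n0) \<Rightarrow> real^'m)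
     \<Rightarrow> real^'n0 \<Rightarrow> ('n, 'n0, 'm) pdvec \<Rightarrow> (nat \<Rightarrow> real) \<Rightarrow> (nat \<Rightarrow> ('n, 'n0, 'm) pdvec) \<Rightarrow> bool" where
  "newton_run \<mu> f c x v0 \<beta> v \<longleftrightarrow> v 0 = v0 \<and>
     (\<forall>j. bij (newton_map \<mu> f c x (v j)) \<and>
        (\<exists>\<Delta>. newton_map \<mu> f c x (v j) \<Delta> = - residual \<mu> f c x (v j) \<and>
             v (Suc j) = v j + \<beta> j *\<^sub>R \<Delta>))"

text \<open>A solver is determined by its line search. \<open>\<beta> x v0\<close> is the sequence of step sizes which
  the line search chooses in the call with input \<open>x\<close> and initial iterate \<open>v0\<close>; nothing is
  assumed about how step \<open>j\<close> depends on the iterates computed so far.\<close>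

definition newton_solver_output ::
    "real \<Rightarrow> ((real^'n) \<times> (real^'n0) \<Rightarrow> real) \<Rightarrow> ((real^'n) \<times> (real^'n0) \<Rightarrow> real^'m)
     \<Rightarrow> (real^'n0 \<Rightarrow> ('n, 'n0, 'm) pdvec \<Rightarrow> nat \<Rightarrow> real)
     \<Rightarrow> real^'n0 \<Rightarrow> ('n, 'n0, 'm) pdvec \<Rightarrow> ('n, 'n0, 'm) pdvec \<Rightarrow> bool" where
  "newton_solver_output \<mu> f c \<beta> x v0 vplus \<longleftrightarrow>
     (\<exists>v. newton_run \<mu> f c x v0 (\<beta> x v0) v \<and> v \<longlonglongrightarrow> vplus)"

text \<open>\<open>Q\<close> is the set of solver calls, each given by the first-stage variable \<open>x\<close> sent to the
  subproblem and the initial iterate used for it; \<open>out x v0 v\<close> says that such a call returns \<open>v\<close>.\<close>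

definition feasibility_assumption ::
    "real \<Rightarrow> ((real^'n) \<times> (real^'n0) \<Rightarrow> real) \<Rightarrow> ((real^'n) \<times> (real^'n0) \<Rightarrow> real^'m)
     \<Rightarrow> (real^'n0 \<Rightarrow> ('n, 'n0, 'm) pdvec \<Rightarrow> ('n, 'n0, 'm) pdvec \<Rightarrow> bool)
     \<Rightarrow> ((real^'n0) \<times> ('n, 'n0, 'm) pdvec) set \<Rightarrow> bool" where
  "feasibility_assumption \<mu> f c out Q \<longleftrightarrow>
     (\<forall>(x, v0)\<in>Q. (\<exists>y. \<forall>j. c (y, x) $ j \<le> 0) \<and> (\<exists>v. out x v0 v \<and> kkt_point \<mu> f c x v))"

text \<open>Warm start: the call for \<open>x + p\<close> starts from the solution \<open>v\<close> computed for \<open>x\<close>.\<close>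

definition consistent_output ::
    "real \<Rightarrow> ((real^'n) \<times> (real^'n0) \<Rightarrow> real) \<Rightarrow> ((real^'n) \<times> (real^'n0) \<Rightarrow> real^'m)
     \<Rightarrow> (real^'n0 \<Rightarrow> ('n, 'n0, 'm) pdvec \<Rightarrow> ('n, 'n0, 'm) pdvec \<Rightarrow> bool)
     \<Rightarrow> real \<Rightarrow> real^'n0 \<Rightarrow> ('n, 'n0, 'm) pdvec \<Rightarrow> bool" where
  "consistent_output \<mu> f c out r2 xb vb \<longleftrightarrow>
     (\<exists>r3>0. \<forall>v0 x v p.
        out x v0 v \<and> (x, v) \<in> stationary_set \<mu> f c \<inter> ball (xb, vb) r3 \<and> norm p \<le> r3 \<longrightarrow>
        (\<exists>vplus. out (x + p) v vplus) \<and>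
        (\<forall>vplus. out (x + p) v vplus \<longrightarrow>
           (x + p, vplus) \<in> stationary_set \<mu> f c \<inter> ball (xb, vb) r2))"

end

theory Submission
  imports Defs
begin

text \<open>The result is a local convergence theorem for damped Newton iterations whose constants are
  uniform in the first-stage variable, and this uniformity comes for free: \<open>x\<close> enters the residual
  only as the constant shift \<open>- x\<close> of its last block (\<open>residual_shift\<close>). Hence all the systems
  \<open>residual \<mu> f c x v = 0\<close> have the same Jacobian in \<open>v\<close> (\<open>newton_map_independent\<close>), and a
  neighbourhood of \<open>vb\<close> that is good for the Newton method at \<open>xb\<close> is good at every \<open>x\<close>. Moreover, a
  point \<open>v\<close> that is stationary for \<open>x\<close> has the residual \<open>(0, 0, 0, 0, - p)\<close> at the input \<open>x + p\<close>, so a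
  warm start begins with a residual of norm \<open>norm p\<close>.

  The Jacobian is continuous and nonsingular at \<open>vb\<close>. Therefore there are \<open>m > 0\<close> and a ball around
  \<open>vb\<close> on which it is bounded below by \<open>m\<close> and on which the linearization error between two points is at
  most \<open>m / 2\<close> times their distance (\<open>C1_uniform_linearization\<close>). There a Newton step with step
  size \<open>b \<le> 1\<close> shrinks the residual by the factor \<open>1 - b / 2\<close>, and the merit function
  \<open>norm (v - vb) + 2 / m * norm (residual \<mu> f c x v)\<close> does not increase (\<open>newton_step\<close>). A run that
  starts with a small merit value thus never leaves the ball. With step sizes bounded away from
  \<open>0\<close> the residuals decay geometrically; the step lengths are bounded by a multiple of them, hence
  summable, and the run converges to a stationary point whose distance from \<open>vb\<close> is at most the
  initial merit value (\<open>run_converges\<close>). That value is below \<open>r3 + 2 / m * r3\<close>, so a small \<open>r3\<close>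
  keeps the output within \<open>r2\<close>.\<close>

section \<open>Calculus of continuously differentiable maps\<close>

lemma blinfun_deriv_apply:
  assumes "g differentiable (at z)"
  shows "blinfun_apply (blinfun_deriv g z) = frechet_derivative g (at z)"
  unfolding blinfun_deriv_def
  using assms by (intro bounded_linear_Blinfun_apply)
    (simp add: frechet_derivative_works has_derivative_bounded_linear)

lemma C1_on_has_derivative:
  assumes "C1_on U g" "z \<in> U"
  shows "(g has_derivative blinfun_apply (blinfun_deriv g z)) (at z)"
  using assms by (simp add: C1_on_def blinfun_deriv_apply frechet_derivative_works[symmetric])

text \<open>In finite dimension, continuity of the derivative in the operator norm can be tested on the
  basis vectors. The criterion with a pointwise derivative is what makes the closure properties
  below short, as no operator-valued derivative has to be written down.\<close>

lemma C1_on_UNIV_iff: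
  fixes g :: "'a::euclidean_space \<Rightarrow> 'b::real_normed_vector"
  shows "C1_on UNIV g \<longleftrightarrow>
    (\<exists>g'. (\<forall>z. (g has_derivative g' z) (at z)) \<and> (\<forall>h. continuous_on UNIV (\<lambda>z. g' z h)))"
proof
  assume g: "C1_on UNIV g"
  have "continuous_on UNIV (\<lambda>z. blinfun_apply (blinfun_deriv g z) h)" for h
    using g by (auto simp: C1_on_def intro!: continuous_intros)
  then show "\<exists>g'. (\<forall>z. (g has_derivative g' z) (at z)) \<and> (\<forall>h. continuous_on UNIV (\<lambda>z. g' z h))"
    using C1_on_has_derivative[OF g] by (intro exI[of _ "\<lambda>z. blinfun_apply (blinfun_deriv g z)"]) auto
next
  assume "\<exists>g'. (\<forall>z. (g has_derivative g' z) (at z)) \<and> (\<forall>h. continuous_on UNIV (\<lambda>z. g' z h))"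
  then obtain g' where g': "\<And>z. (g has_derivative g' z) (at z)"
    and cont: "\<And>h. continuous_on UNIV (\<lambda>z. g' z h)" by blast
  have diff: "g differentiable (at z)" for z
    using g' by (rule differentiableI)
  have "blinfun_apply (blinfun_deriv g z) = g' z" for z
    using blinfun_deriv_apply[OF diff] frechet_derivative_at[OF g'] by simp
  with cont show "C1_on UNIV g"
    unfolding C1_on_def by (auto intro!: continuous_on_blinfun_componentwise diff)
qed

lemma C1_on_UNIV_I:
  fixes g :: "'a::euclidean_space \<Rightarrow> 'b::real_normed_vector"
  assumes "\<And>z. (g has_derivative g' z) (at z)" "\<And>h. continuous_on UNIV (\<lambda>z. g' z h)"
  shows "C1_on UNIV g"
  using assms unfolding C1_on_UNIV_iff by blast

lemma C1_on_imp_continuous_on: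
  assumes "C1_on U g"
  shows "continuous_on U g"
  using assms by (intro continuous_at_imp_continuous_on ballI differentiable_imp_continuous_within)
    (simp add: C1_on_def)

lemma C1_on_UNIV_bounded_linear:
  fixes L :: "'a::euclidean_space \<Rightarrow> 'b::real_normed_vector"
  assumes "bounded_linear L"
  shows "C1_on UNIV L"
  using assms by (intro C1_on_UNIV_I[where g' = "\<lambda>_. L"] bounded_linear_imp_has_derivative) auto

lemma C1_on_UNIV_const: "C1_on UNIV (\<lambda>_::'a::euclidean_space. k :: 'b::real_normed_vector)"
  by (rule C1_on_UNIV_I[where g' = "\<lambda>_ _. 0"]) auto

lemma C1_on_UNIV_add:
  fixes g h :: "'a::euclidean_space \<Rightarrow> 'b::real_normed_vector"
  assumes "C1_on UNIV g" "C1_on UNIV h"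
  shows "C1_on UNIV (\<lambda>z. g z + h z)"
proof -
  obtain g' where "\<forall>z. (g has_derivative g' z) (at z)" "\<forall>k. continuous_on UNIV (\<lambda>z. g' z k)"
    using assms(1) unfolding C1_on_UNIV_iff by blast
  note g = this[rule_format]
  obtain h' where "\<forall>z. (h has_derivative h' z) (at z)" "\<forall>k. continuous_on UNIV (\<lambda>z. h' z k)"
    using assms(2) unfolding C1_on_UNIV_iff by blast
  note h = this[rule_format]
  show ?thesis
    by (rule C1_on_UNIV_I[where g' = "\<lambda>z k. g' z k + h' z k"])
      (intro has_derivative_add continuous_on_add g h)+
qed

lemma C1_on_UNIV_bilinear:
  fixes g :: "'a::euclidean_space \<Rightarrow> 'b::real_normed_vector"
    and h :: "'a \<Rightarrow> 'c::real_normed_vector" and prod :: "'b \<Rightarrow> 'c \<Rightarrow> 'd::real_normed_vector"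
  assumes "bounded_bilinear prod" "C1_on UNIV g" "C1_on UNIV h"
  shows "C1_on UNIV (\<lambda>z. prod (g z) (h z))"
proof -
  obtain g' where "\<forall>z. (g has_derivative g' z) (at z)" "\<forall>k. continuous_on UNIV (\<lambda>z. g' z k)"
    using assms(2) unfolding C1_on_UNIV_iff by blast
  note g = this[rule_format]
  obtain h' where "\<forall>z. (h has_derivative h' z) (at z)" "\<forall>k. continuous_on UNIV (\<lambda>z. h' z k)"
    using assms(3) unfolding C1_on_UNIV_iff by blast
  note h = this[rule_format]
  show ?thesis
    by (rule C1_on_UNIV_I[where g' = "\<lambda>z k. prod (g z) (h' z k) + prod (g' z k) (h z)"])
      (intro bounded_bilinear.FDERIV[OF assms(1)] continuous_on_add
         bounded_bilinear.continuous_on[OF assms(1)] g h C1_on_imp_continuous_on assms(2,3))+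
qed

lemma C1_on_UNIV_Pair:
  fixes g :: "'a::euclidean_space \<Rightarrow> 'b::real_normed_vector" and h :: "'a \<Rightarrow> 'c::real_normed_vector"
  assumes "C1_on UNIV g" "C1_on UNIV h"
  shows "C1_on UNIV (\<lambda>z. (g z, h z))"
proof -
  obtain g' where "\<forall>z. (g has_derivative g' z) (at z)" "\<forall>k. continuous_on UNIV (\<lambda>z. g' z k)"
    using assms(1) unfolding C1_on_UNIV_iff by blast
  note g = this[rule_format]
  obtain h' where "\<forall>z. (h has_derivative h' z) (at z)" "\<forall>k. continuous_on UNIV (\<lambda>z. h' z k)"
    using assms(2) unfolding C1_on_UNIV_iff by blast
  note h = this[rule_format]
  show ?thesis
    by (rule C1_on_UNIV_I[where g' = "\<lambda>z k. (g' z k, h' z k)"])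
      (intro has_derivative_Pair continuous_on_Pair g h)+
qed

lemma C1_on_UNIV_vec_lambda:
  fixes g :: "'a::euclidean_space \<Rightarrow> 'i::finite \<Rightarrow> real"
  assumes "\<And>i. C1_on UNIV (\<lambda>z. g z i)"
  shows "C1_on UNIV (\<lambda>z. \<chi> i. g z i)"
proof -
  have "\<forall>i. \<exists>g'. (\<forall>z. ((\<lambda>z. g z i) has_derivative g' z) (at z)) \<and> (\<forall>h. continuous_on UNIV (\<lambda>z. g' z h))"
    using assms by (simp add: C1_on_UNIV_iff)
  from choice[OF this] obtain g' where
    "\<forall>i. (\<forall>z. ((\<lambda>z. g z i) has_derivative g' i z) (at z)) \<and> (\<forall>h. continuous_on UNIV (\<lambda>z. g' i z h))" ..
  then have g': "\<And>i z. ((\<lambda>z. g z i) has_derivative g' i z) (at z)"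
    "\<And>i h. continuous_on UNIV (\<lambda>z. g' i z h)" by simp_all
  have "((\<lambda>z. \<chi> i. g z i) has_derivative (\<lambda>h. \<chi> i. g' i z h)) (at z)" for z
    using g'(1)
    by (subst has_derivative_componentwise_within) (auto simp: Basis_vec_def inner_axis)
  then show ?thesis
    using g'(2) by (intro C1_on_UNIV_I[where g' = "\<lambda>z h. \<chi> i. g' i z h"])
      (auto intro!: continuous_on_vec_lambda)
qed

lemma C1_on_UNIV_compose_linear:
  fixes g :: "'b::euclidean_space \<Rightarrow> 'c::real_normed_vector"
    and L :: "'a::euclidean_space \<Rightarrow> 'b"
  assumes "bounded_linear L" "C1_on UNIV g"
  shows "C1_on UNIV (\<lambda>z. g (L z))"
proof -
  obtain g' where "\<forall>z. (g has_derivative g' z) (at z)" "\<forall>k. continuous_on UNIV (\<lambda>z. g' z k)"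
    using assms(2) unfolding C1_on_UNIV_iff by blast
  note g = this[rule_format]
  have "continuous_on UNIV (\<lambda>z. g' (L z) (L k))" for k
    by (rule continuous_on_compose2[OF g(2) linear_continuous_on[OF assms(1)] subset_UNIV])
  with has_derivative_compose[OF bounded_linear_imp_has_derivative[OF assms(1)] g(1)]
  show ?thesis
    by (rule C1_on_UNIV_I[where g' = "\<lambda>z k. g' (L z) (L k)"])
qed


section \<open>The residual of the smoothed subproblem\<close>

lemma gradient_has_derivative:
  assumes "(g has_derivative g') (at z)"
  shows "gradient g z = (\<chi> i. g' (axis i 1))"
  using assms by (simp add: gradient_def frechet_derivative_at[symmetric])

text \<open>The gradient blocks written with the total derivatives of \<open>f\<close> and \<open>c\<close>. In this form the
  dependence on \<open>x\<close> is visible, and smoothness of the residual reduces to that of the maps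
  \<open>blinfun_deriv f\<close> and \<open>blinfun_deriv c\<close>.\<close>

lemma residual_eq:
  fixes f :: "(real^'n) \<times> (real^'n0) \<Rightarrow> real" and c :: "(real^'n) \<times> (real^'n0) \<Rightarrow> real^'m"
  assumes f: "C1_on UNIV f" and c: "C1_on UNIV c"
  shows "residual \<mu> f c x (y, xt, s, lam, eta) =
     ((\<chi> i. blinfun_deriv f (y, xt) (axis i 1, 0) + blinfun_deriv c (y, xt) (axis i 1, 0) \<bullet> lam),
      (\<chi> i. blinfun_deriv f (y, xt) (0, axis i 1) + blinfun_deriv c (y, xt) (0, axis i 1) \<bullet> lam + eta $ i),
      (\<chi> j. s $ j * lam $ j - \<mu>), c (y, xt) + s, xt - x)"
proof -
  note df = C1_on_has_derivative[OF f UNIV_I] and dc = C1_on_has_derivative[OF c UNIV_I]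
  have py: "((\<lambda>y'. (y', xt)) has_derivative (\<lambda>h. (h, 0))) (at y)"
    by (auto intro!: derivative_eq_intros)
  have px: "((\<lambda>xt'. (y, xt')) has_derivative (\<lambda>h. (0, h))) (at xt)"
    by (auto intro!: derivative_eq_intros)
  have "((\<lambda>y'. lagrangian f c x (y', xt, s, lam, eta)) has_derivative
      (\<lambda>h. blinfun_deriv f (y, xt) (h, 0) + blinfun_deriv c (y, xt) (h, 0) \<bullet> lam)) (at y)"
    unfolding lagrangian_def prod.case
    by (rule derivative_eq_intros has_derivative_compose[OF py df] has_derivative_compose[OF py dc] refl | simp)+
  note gy = gradient_has_derivative[OF this]
  have "((\<lambda>xt'. lagrangian f c x (y, xt', s, lam, eta)) has_derivative
      (\<lambda>h. blinfun_deriv f (y, xt) (0, h) + blinfun_deriv c (y, xt) (0, h) \<bullet> lam + h \<bullet> eta)) (at xt)"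
    unfolding lagrangian_def prod.case
    by (rule derivative_eq_intros has_derivative_compose[OF px df] has_derivative_compose[OF px dc] refl | simp)+
  note gx = gradient_has_derivative[OF this]
  show ?thesis
    by (simp add: residual_def gy gx inner_axis')
qed

text \<open>The first-stage variable enters the residual only through the block \<open>xt - x\<close>: the term
  \<open>(xt - x) \<bullet> eta\<close> of the Lagrangian contributes the gradient \<open>eta\<close>, whatever \<open>x\<close> is.\<close>

lemma residual_shift:
  fixes f :: "(real^'n) \<times> (real^'n0) \<Rightarrow> real" and c :: "(real^'n) \<times> (real^'n0) \<Rightarrow> real^'m"
  assumes "C1_on UNIV f" "C1_on UNIV c"
  shows "residual \<mu> f c x v = residual \<mu> f c x' v - (0, 0, 0, 0, x - x')"
  by (cases v) (simp add: residual_eq[OF assms])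

lemma residual_C1:
  fixes f :: "(real^'n) \<times> (real^'n0) \<Rightarrow> real" and c :: "(real^'n) \<times> (real^'n0) \<Rightarrow> real^'m"
  assumes f: "C1_on UNIV f" "C1_on UNIV (blinfun_deriv f)"
    and c: "C1_on UNIV c" "C1_on UNIV (blinfun_deriv c)"
  shows "C1_on UNIV (residual \<mu> f c x)"
proof -
  let ?z = "\<lambda>v::('n, 'n0, 'm) pdvec. (fst v, fst (snd v))"
  let ?s = "\<lambda>v::('n, 'n0, 'm) pdvec. fst (snd (snd v))"
  let ?lam = "\<lambda>v::('n, 'n0, 'm) pdvec. fst (snd (snd (snd v)))"
  let ?eta = "\<lambda>v::('n, 'n0, 'm) pdvec. snd (snd (snd (snd v)))"
  have lin: "bounded_linear ?z" "bounded_linear ?s" "bounded_linear ?lam" "bounded_linear ?eta"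
    "bounded_linear (\<lambda>v::('n, 'n0, 'm) pdvec. fst (snd v))"
    by (intro bounded_linear_Pair bounded_linear_fst bounded_linear_snd bounded_linear_fst_comp bounded_linear_snd_comp)+
  note along_z = C1_on_UNIV_compose_linear[OF lin(1)]
  have entries:
    "C1_on UNIV (\<lambda>v. blinfun_deriv f (?z v) k + blinfun_deriv c (?z v) k \<bullet> ?lam v)" for k
    by (intro C1_on_UNIV_add
        C1_on_UNIV_bilinear[OF bounded_bilinear_inner _ C1_on_UNIV_bounded_linear[OF lin(3)]]
        C1_on_UNIV_bilinear[OF bounded_bilinear_blinfun_apply along_z[OF f(2)] C1_on_UNIV_const]
        C1_on_UNIV_bilinear[OF bounded_bilinear_blinfun_apply along_z[OF c(2)] C1_on_UNIV_const])
  have coords: "C1_on UNIV (\<lambda>v. ?s v $ j)" "C1_on UNIV (\<lambda>v. ?lam v $ j)" "C1_on UNIV (\<lambda>v. ?eta v $ i)" for i j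
    by (rule C1_on_UNIV_bounded_linear, rule bounded_linear_compose[OF bounded_linear_vec_nth], rule lin)+
  \<comment> \<open>Differences are written as sums, so that the sum rule covers every block.\<close>
  have eq: "residual \<mu> f c x = (\<lambda>v.
     ((\<chi> i. blinfun_deriv f (?z v) (axis i 1, 0) + blinfun_deriv c (?z v) (axis i 1, 0) \<bullet> ?lam v),
      (\<chi> i. blinfun_deriv f (?z v) (0, axis i 1) + blinfun_deriv c (?z v) (0, axis i 1) \<bullet> ?lam v + ?eta v $ i),
      (\<chi> j. ?s v $ j * ?lam v $ j + - \<mu>), c (?z v) + ?s v, fst (snd v) + - x))"
    by (auto simp: fun_eq_iff residual_eq[OF f(1) c(1)])
  show ?thesis
    unfolding eq
    by (intro C1_on_UNIV_Pair C1_on_UNIV_vec_lambda entries C1_on_UNIV_add[OF entries coords(3)]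
        C1_on_UNIV_add[OF C1_on_UNIV_bilinear[OF bounded_bilinear_mult coords(1,2)] C1_on_UNIV_const]
        C1_on_UNIV_add[OF along_z[OF c(1)] C1_on_UNIV_bounded_linear[OF lin(2)]]
        C1_on_UNIV_add[OF C1_on_UNIV_bounded_linear[OF lin(5)] C1_on_UNIV_const])
qed

lemma newton_map_independent:
  fixes f :: "(real^'n) \<times> (real^'n0) \<Rightarrow> real" and c :: "(real^'n) \<times> (real^'n0) \<Rightarrow> real^'m"
  assumes f: "C1_on UNIV f" "C1_on UNIV (blinfun_deriv f)"
    and c: "C1_on UNIV c" "C1_on UNIV (blinfun_deriv c)"
  shows "newton_map \<mu> f c x v = newton_map \<mu> f c x' v"
proof -
  have "(residual \<mu> f c x' has_derivative newton_map \<mu> f c x' v) (at v)"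
    using residual_C1[OF f c, of \<mu> x']
    by (simp del: split_paired_All add: C1_on_def newton_map_def frechet_derivative_works[symmetric])
  then have "((\<lambda>v. residual \<mu> f c x' v - (0, 0, 0, 0, x - x')) has_derivative newton_map \<mu> f c x' v) (at v)"
    by (auto intro!: derivative_eq_intros)
  then have "(residual \<mu> f c x has_derivative newton_map \<mu> f c x' v) (at v)"
    by (simp only: residual_shift[OF f(1) c(1), of \<mu> x _ x', symmetric])
  then show ?thesis by (simp add: newton_map_def frechet_derivative_at[symmetric])
qed


section \<open>Local convergence of damped Newton iterations\<close>

text \<open>If \<open>B\<close> is a lower bound for the derivative at \<open>vb\<close> and the derivative varies by at most
  \<open>B / 8\<close> from its value at \<open>vb\<close>, then it is still bounded below by \<open>B / 2\<close>, hence injective and,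
  in finite dimension, bijective; and two derivatives in the ball differ by at most \<open>B / 4\<close>, which
  bounds the linearization error by the mean value inequality. The conclusion is for \<open>m = B / 2\<close>.\<close>

lemma C1_uniform_linearization:
  fixes G :: "'a::euclidean_space \<Rightarrow> 'a"
  assumes G: "C1_on UNIV G" and bij: "bij (frechet_derivative G (at vb))"
  obtains m \<rho> where "m > 0" "\<rho> > 0"
    "\<And>v. v \<in> ball vb \<rho> \<Longrightarrow> bij (frechet_derivative G (at v))"
    "\<And>v h. v \<in> ball vb \<rho> \<Longrightarrow> m * norm h \<le> norm (frechet_derivative G (at v) h)"
    "\<And>u v. \<lbrakk>u \<in> ball vb \<rho>; v \<in> ball vb \<rho>\<rbrakk> \<Longrightarrow>
       norm (G u - G v - frechet_derivative G (at v) (u - v)) \<le> m / 2 * norm (u - v)"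
proof -
  let ?D = "blinfun_deriv G"
  have D: "frechet_derivative G (at v) = blinfun_apply (?D v)" for v
    using G by (simp add: C1_on_def blinfun_deriv_apply)
  obtain B where B: "B > 0" "\<And>h. B * norm h \<le> norm (?D vb h)"
    using linear_inj_bounded_below_pos[of "blinfun_apply (?D vb)"] bij
    by (auto simp: D bij_def bounded_linear.linear[OF blinfun.bounded_linear_right])
  have "isCont ?D vb"
    using G by (simp add: C1_on_def continuous_on_eq_continuous_at)
  then obtain \<rho> where \<rho>: "\<rho> > 0" "\<And>v. dist v vb < \<rho> \<Longrightarrow> dist (?D v) (?D vb) < B / 8"
    using B(1) by (metis continuous_at_eps_delta divide_pos_pos zero_less_numeral)
  have close: "norm (?D v - ?D vb) \<le> B / 8" if "v \<in> ball vb \<rho>" for v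
    using \<rho>(2)[of v] that by (simp add: dist_norm norm_minus_commute)
  have below: "B / 2 * norm h \<le> norm (?D v h)" if "v \<in> ball vb \<rho>" for v h
  proof -
    have "norm ((?D v - ?D vb) h) \<le> B / 8 * norm h"
      by (rule order_trans[OF norm_blinfun]) (intro mult_right_mono close that norm_ge_zero)
    moreover have "norm (?D vb h) \<le> norm (?D v h) + norm ((?D v - ?D vb) h)"
      using norm_triangle_ineq4[of "?D v h" "(?D v - ?D vb) h"] by (simp add: blinfun.diff_left)
    moreover have "B / 8 * norm h \<le> B / 2 * norm h"
      using B(1) by (intro mult_right_mono) auto
    ultimately show ?thesis using B(2)[of h] by (simp add: field_simps)
  qed
  have bij': "bij (blinfun_apply (?D v))" if "v \<in> ball vb \<rho>" for v
  proof -
    have lin: "linear (blinfun_apply (?D v))"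
      by (rule bounded_linear.linear[OF blinfun.bounded_linear_right])
    have "inj (blinfun_apply (?D v))"
      unfolding linear_injective_0[OF lin]
    proof (intro allI impI)
      fix h assume "?D v h = 0"
      then have "B / 2 * norm h \<le> 0" using below[OF that, of h] by simp
      then show "h = 0" using B(1) by (simp add: mult_le_0_iff)
    qed
    then show ?thesis using linear_injective_imp_surjective[OF lin] by (simp add: bij_def)
  qed
  have lin_err: "norm (G u - G v - ?D v (u - v)) \<le> B / 2 / 2 * norm (u - v)"
    if u: "u \<in> ball vb \<rho>" and v: "v \<in> ball vb \<rho>" for u v
  proof -
    have seg: "v + t *\<^sub>R (u - v) \<in> ball vb \<rho>" if "t \<in> {0..1}" for t
      using convexD_alt[OF convex_ball v u, of t] that by (simp add: algebra_simps)
    have "norm (G u - G v - ?D v (u - v)) \<le> norm (u - v) * (B / 4)"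
    proof (rule differentiable_bound_linearization[OF seg _ _ v])
      show "(G has_derivative blinfun_apply (?D w)) (at w within ball vb \<rho>)" for w
        using C1_on_has_derivative[OF G UNIV_I] by (rule has_derivative_at_withinI)
      fix w assume w: "w \<in> ball vb \<rho>"
      have "norm (?D w - ?D v) \<le> norm (?D w - ?D vb) + norm (?D v - ?D vb)"
        using norm_triangle_ineq4[of "?D w - ?D vb" "?D v - ?D vb"] by simp
      also have "\<dots> \<le> B / 4" using close[OF w] close[OF v] by simp
      finally show "onorm (blinfun_apply (?D w) - blinfun_apply (?D v)) \<le> B / 4"
        by (simp add: norm_blinfun.rep_eq minus_blinfun.rep_eq fun_diff_def)
    qed
    then show ?thesis by (simp add: mult.commute)
  qed
  show ?thesis
    using that[of "B / 2" \<rho>] B(1) \<rho>(1) bij' below lin_err unfolding D by simp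
qed

text \<open>The conditions on \<open>G\<close> and its derivative \<open>D\<close> do not change when a constant is added to
  \<open>G\<close>; this allows one neighbourhood to serve all values of the first-stage variable.\<close>

locale newton_neighbourhood =
  fixes G :: "'a::euclidean_space \<Rightarrow> 'a" and D :: "'a \<Rightarrow> 'a \<Rightarrow> 'a" and vb :: 'a and m \<rho> :: real
  assumes m_pos: "m > 0"
    and linear_D: "\<And>v. linear (D v)"
    and bij_D: "\<And>v. v \<in> ball vb \<rho> \<Longrightarrow> bij (D v)"
    and D_below: "\<And>v h. v \<in> ball vb \<rho> \<Longrightarrow> m * norm h \<le> norm (D v h)"
    and linearization: "\<And>u v. \<lbrakk>u \<in> ball vb \<rho>; v \<in> ball vb \<rho>\<rbrakk> \<Longrightarrow>
       norm (G u - G v - D v (u - v)) \<le> m / 2 * norm (u - v)"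
begin

definition merit :: "'a \<Rightarrow> real" where
  "merit v = norm (v - vb) + 2 / m * norm (G v)"

lemma merit_ball:
  assumes "merit v < \<rho>" shows "v \<in> ball vb \<rho>"
proof -
  have "0 \<le> 2 / m * norm (G v)" using m_pos by simp
  then have "norm (v - vb) < \<rho>" using assms by (simp add: merit_def del: times_divide_eq_left)
  then show ?thesis by (simp add: dist_norm norm_minus_commute)
qed

text \<open>Since \<open>D v (b *\<^sub>R \<Delta>) = - b *\<^sub>R G v\<close>, the linear model of \<open>G\<close> at the new point is
  \<open>(1 - b) *\<^sub>R G v\<close>, and its error is at most \<open>m / 2 * b * norm \<Delta> \<le> b / 2 * norm (G v)\<close>. So a
  step removes at least the fraction \<open>b / 2\<close> of the residual, while it moves the iterate by at
  most \<open>b * norm (G v) / m\<close>; the weight \<open>2 / m\<close> in the merit function makes the gain in the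
  residual term pay for the loss in the distance term.\<close>

lemma newton_step:
  assumes start: "merit v < \<rho>" and b: "b \<in> {0<..1}" and newton: "D v \<Delta> = - G v"
  shows residual_contraction: "norm (G (v + b *\<^sub>R \<Delta>)) \<le> (1 - b / 2) * norm (G v)"
    and merit_decreases: "merit (v + b *\<^sub>R \<Delta>) \<le> merit v"
    and step_length: "norm (b *\<^sub>R \<Delta>) \<le> norm (G v) / m"
proof -
  note v = merit_ball[OF start]
  have len: "norm (b *\<^sub>R \<Delta>) \<le> b * norm (G v) / m"
    using D_below[OF v, of \<Delta>] m_pos b by (simp add: newton field_simps)
  have "b * norm (G v) / m \<le> norm (G v) / m"
    using b m_pos by (intro divide_right_mono mult_left_le_one_le) auto
  then show len1: "norm (b *\<^sub>R \<Delta>) \<le> norm (G v) / m" using len by simp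
  have tri: "norm (v + b *\<^sub>R \<Delta> - vb) \<le> norm (v - vb) + norm (b *\<^sub>R \<Delta>)"
    using norm_triangle_ineq[of "v - vb" "b *\<^sub>R \<Delta>"] by (simp add: algebra_simps)
  have "norm (G v) / m \<le> 2 / m * norm (G v)"
    using m_pos by (simp add: field_simps)
  \<comment> \<open>The linearization bound may be used only once the new point is known to lie in the ball.\<close>
  then have "v + b *\<^sub>R \<Delta> \<in> ball vb \<rho>"
    using tri len1 start by (simp add: merit_def dist_norm norm_minus_commute)
  from linearization[OF this v]
  have "norm (G (v + b *\<^sub>R \<Delta>) - (1 - b) *\<^sub>R G v) \<le> m / 2 * norm (b *\<^sub>R \<Delta>)"
    by (simp add: linear_scale[OF linear_D] newton algebra_simps)
  also have "\<dots> \<le> m / 2 * (b * norm (G v) / m)"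
    using len m_pos by (intro mult_left_mono) auto
  also have "\<dots> = b / 2 * norm (G v)" using m_pos by simp
  finally have "norm (G (v + b *\<^sub>R \<Delta>)) \<le> b / 2 * norm (G v) + norm ((1 - b) *\<^sub>R G v)"
    using norm_triangle_ineq2[of "G (v + b *\<^sub>R \<Delta>)" "(1 - b) *\<^sub>R G v"] by linarith
  also have "norm ((1 - b) *\<^sub>R G v) = (1 - b) * norm (G v)" using b by simp
  also have "b / 2 * norm (G v) + (1 - b) * norm (G v) = (1 - b / 2) * norm (G v)"
    by (simp add: algebra_simps)
  finally show contr: "norm (G (v + b *\<^sub>R \<Delta>)) \<le> (1 - b / 2) * norm (G v)" .
  have "2 / m * norm (G (v + b *\<^sub>R \<Delta>)) \<le> 2 / m * ((1 - b / 2) * norm (G v))"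
    using contr m_pos by (intro mult_left_mono) auto
  also have "\<dots> = 2 / m * norm (G v) - b * norm (G v) / m"
    using m_pos by (simp add: field_simps)
  finally show "merit (v + b *\<^sub>R \<Delta>) \<le> merit v"
    using tri len unfolding merit_def by linarith
qed

text \<open>A Newton run does not break down: the merit function keeps it in the ball, where all
  Newton systems are nonsingular.\<close>

lemma run_exists:
  assumes "merit v0 < \<rho>" "\<And>j. b j \<in> {0<..1}"
  obtains v where "v 0 = v0"
    "\<And>j. bij (D (v j)) \<and> (\<exists>\<Delta>. D (v j) \<Delta> = - G (v j) \<and> v (Suc j) = v j + b j *\<^sub>R \<Delta>)"
proof -
  define \<Delta> where "\<Delta> w = inv (D w) (- G w)" for w
  define v where "v = rec_nat v0 (\<lambda>j w. w + b j *\<^sub>R \<Delta> w)"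
  have v_simps: "v 0 = v0" "\<And>j. v (Suc j) = v j + b j *\<^sub>R \<Delta> (v j)" by (simp_all add: v_def)
  have newton: "D w (\<Delta> w) = - G w" if "merit w < \<rho>" for w
    using bij_D[OF merit_ball[OF that]] by (simp add: \<Delta>_def bij_is_surj surj_f_inv_f)
  have "merit (v j) < \<rho>" for j
  proof (induction j)
    case (Suc j)
    show ?case using merit_decreases[OF Suc assms(2)[of j] newton[OF Suc]] Suc by (simp add: v_simps)
  qed (simp add: v_simps assms)
  then show ?thesis
    using that[of v] v_simps newton bij_D merit_ball by blast
qed

text \<open>The residuals are bounded by a geometric sequence of ratio \<open>1 - bmin / 2\<close>, so the steps
  are summable. The limit is a zero of \<open>G\<close> by continuity, and it inherits the bound
  \<open>norm (v j - vb) \<le> merit (v 0)\<close> from the iterates.\<close>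

lemma run_converges:
  assumes cont: "continuous_on UNIV G"
    and start: "merit (v 0) < \<rho>" and b: "\<And>j. b j \<in> {0<..1}"
    and bmin: "bmin > 0" "\<And>j. b j \<ge> bmin"
    and run: "\<And>j. \<exists>\<Delta>. D (v j) \<Delta> = - G (v j) \<and> v (Suc j) = v j + b j *\<^sub>R \<Delta>"
  obtains w where "v \<longlonglongrightarrow> w" "G w = 0" "norm (w - vb) \<le> merit (v 0)"
proof -
  define q where "q = 1 - bmin / 2"
  have q: "0 \<le> q" "q < 1" using bmin b[of 0] order_trans[OF bmin(2)[of 0], of 1] by (auto simp: q_def)
  obtain \<Delta> where \<Delta>: "\<And>j. D (v j) (\<Delta> j) = - G (v j)" "\<And>j. v (Suc j) = v j + b j *\<^sub>R \<Delta> j"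
    using run by metis
  have inv: "merit (v j) \<le> merit (v 0) \<and> norm (G (v j)) \<le> q ^ j * norm (G (v 0))" for j
  proof (induction j)
    case (Suc j)
    then have "merit (v j) < \<rho>" using start by simp
    note st = newton_step[OF this b[of j] \<Delta>(1)]
    have "norm (G (v (Suc j))) \<le> (1 - b j / 2) * norm (G (v j))" using st(1) by (simp add: \<Delta>(2))
    also have "\<dots> \<le> q * norm (G (v j))"
      using bmin(2)[of j] by (intro mult_right_mono) (auto simp: q_def)
    also have "\<dots> \<le> q * (q ^ j * norm (G (v 0)))"
      using Suc q by (intro mult_left_mono) auto
    finally show ?case using st(2) Suc by (simp add: \<Delta>(2) mult.assoc)
  qed simp
  have geom: "(\<lambda>j. q ^ j * norm (G (v 0))) \<longlonglongrightarrow> 0"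
    using q by (intro tendsto_mult_left_zero LIMSEQ_realpow_zero) auto
  have step_le: "norm (v (Suc j) - v j) \<le> q ^ j * norm (G (v 0)) / m" for j
  proof -
    have "merit (v j) < \<rho>" using inv[of j] start by simp
    then have "norm (v (Suc j) - v j) \<le> norm (G (v j)) / m"
      using step_length[OF _ b[of j] \<Delta>(1)] by (simp add: \<Delta>(2))
    also have "\<dots> \<le> q ^ j * norm (G (v 0)) / m" using inv[of j] m_pos by (intro divide_right_mono) auto
    finally show ?thesis .
  qed
  have "summable (\<lambda>j. q ^ j * norm (G (v 0)) / m)"
    using q by (intro summable_divide summable_mult2 summable_geometric) auto
  then have "summable (\<lambda>j. v (Suc j) - v j)"
    by (rule summable_comparison_test'[OF _ step_le])
  then have "convergent (\<lambda>n. \<Sum>j<n. v (Suc j) - v j)"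
    by (simp add: summable_iff_convergent)
  then have "convergent (\<lambda>n. (v n - v 0) + v 0)"
    unfolding sum_lessThan_telescope by (intro convergent_add convergent_const)
  then obtain w where w: "v \<longlonglongrightarrow> w" by (auto simp: convergent_def)
  have "(\<lambda>j. G (v j)) \<longlonglongrightarrow> G w"
    using cont w by (auto simp: continuous_on_eq_continuous_at intro: isCont_tendsto_compose)
  moreover have "(\<lambda>j. G (v j)) \<longlonglongrightarrow> 0"
    using inv by (intro Lim_null_comparison[OF _ geom]) auto
  ultimately have "G w = 0" by (rule LIMSEQ_unique)
  have "norm (v j - vb) \<le> merit (v 0)" for j
  proof -
    have "0 \<le> 2 / m * norm (G (v j))" using m_pos by simp
    then show ?thesis using inv[of j] unfolding merit_def by linarith
  qed
  then have "norm (w - vb) \<le> merit (v 0)"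
    by (intro LIMSEQ_le_const2[OF tendsto_norm[OF tendsto_diff[OF w tendsto_const]]]) auto
  with w \<open>G w = 0\<close> show ?thesis by (rule that)
qed

end

section \<open>Consistent output\<close>

theorem lemma5p8:
  fixes \<mu> r1 r2 \<beta>min :: real
    and sm :: smoothing
    and f\<^sub>0 :: "real^'n0 \<Rightarrow> real" and c\<^sub>0 :: "real^'n0 \<Rightarrow> real^'m0"
    and f :: "(real^'n) \<times> (real^'n0) \<Rightarrow> real" and c :: "(real^'n) \<times> (real^'n0) \<Rightarrow> real^'m"
    and \<beta> :: "real^'n0 \<Rightarrow> ('n, 'n0, 'm) pdvec \<Rightarrow> nat \<Rightarrow> real"
    and Q :: "((real^'n0) \<times> ('n, 'n0, 'm) pdvec) set"
    and xb :: "real^'n0" and vb :: "('n, 'n0, 'm) pdvec"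
  assumes "\<mu> > 0"
    and "feasibility_assumption \<mu> f c (newton_solver_output \<mu> f c \<beta>) Q"
    and "regularity_assumption sm f\<^sub>0 c\<^sub>0 f c"
    and "nondegenerate_stationary \<mu> f c xb vb"
    and "solution_map_radii \<mu> f c xb vb r1 r2"
    and "\<And>x v0 j. \<beta> x v0 j \<in> {0<..1}"
    and "\<beta>min \<in> {0<..1}"
    and "\<And>x v0 j. \<beta> x v0 j \<ge> \<beta>min"
  shows "consistent_output \<mu> f c (newton_solver_output \<mu> f c \<beta>) r2 xb vb \<and>
    (\<exists>r3>0. \<forall>x v p.
       (x, v) \<in> ball (xb, vb) r3 \<inter> stationary_set \<mu> f c \<and> norm p \<le> r3 \<longrightarrow>
       (\<exists>vplus. newton_solver_output \<mu> f c \<beta> (x + p) v vplus \<and>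
          residual \<mu> f c (x + p) vplus = 0 \<and>
          (x + p, vplus) \<in> ball (xb, vb) r2))"
proof -
  have f: "C1_on UNIV f" "C1_on UNIV (blinfun_deriv f)"
    and c: "C1_on UNIV c" "C1_on UNIV (blinfun_deriv c)"
    using assms(3) by (auto simp: regularity_assumption_def C2_lip_def C3_def split: smoothing.splits)
  have C1: "C1_on UNIV (residual \<mu> f c x)" for x
    using residual_C1[OF f c] .
  note shift = residual_shift[OF f(1) c(1), of \<mu>]
  note newton_map_indep = newton_map_independent[OF f c, of \<mu> _ _ xb]
  have "bij (frechet_derivative (residual \<mu> f c xb) (at vb))"
    using assms(4) by (simp add: nondegenerate_stationary_def newton_map_def)
  from C1_uniform_linearization[OF C1 this] obtain m \<rho> where
    m: "m > 0" and \<rho>: "\<rho> > 0"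
    and bij: "\<And>v. v \<in> ball vb \<rho> \<Longrightarrow> bij (newton_map \<mu> f c xb v)"
    and below: "\<And>v h. v \<in> ball vb \<rho> \<Longrightarrow> m * norm h \<le> norm (newton_map \<mu> f c xb v h)"
    and err: "\<And>u v. \<lbrakk>u \<in> ball vb \<rho>; v \<in> ball vb \<rho>\<rbrakk> \<Longrightarrow>
       norm (residual \<mu> f c xb u - residual \<mu> f c xb v - newton_map \<mu> f c xb v (u - v))
         \<le> m / 2 * norm (u - v)"
    unfolding newton_map_def by metis
  have nbhd: "newton_neighbourhood (residual \<mu> f c x) (newton_map \<mu> f c x) vb m \<rho>" for x
  proof (rule newton_neighbourhood.intro)
    fix u v assume uv: "u \<in> ball vb \<rho>" "v \<in> ball vb \<rho>"
    show "norm (residual \<mu> f c x u - residual \<mu> f c x v - newton_map \<mu> f c x v (u - v))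
         \<le> m / 2 * norm (u - v)"
      using err[OF uv] by (simp add: shift[of x _ xb] newton_map_indep[of x])
  next
    show "linear (newton_map \<mu> f c x v)" for v
      unfolding newton_map_def using C1[of x]
      by (intro linear_frechet_derivative) (simp del: split_paired_All add: C1_on_def)
  qed (use m bij below in \<open>auto simp: newton_map_indep[of x]\<close>)
  \<comment> \<open>A distance below \<open>r3\<close> from \<open>x\<close> to \<open>xb\<close>, the length of \<open>p\<close>, and the initial merit value, which is
    below \<open>r3 + 2 / m * r3\<close>, add up to less than \<open>(3 + 2 / m) * r3\<close>. This bounds the distance of
    the output from \<open>(xb, vb)\<close>.\<close>
  define r3 where "r3 = min \<rho> r2 / (3 + 2 / m)"
  have "r2 > 0" using assms(5) by (simp add: solution_map_radii_def)
  moreover have "3 + 2 / m > 0" using m by (simp add: add_pos_pos)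
  ultimately have r3: "r3 > 0" "(3 + 2 / m) * r3 = min \<rho> r2"
    using \<rho> by (simp_all add: r3_def)
  have key: "(\<exists>vplus. newton_solver_output \<mu> f c \<beta> (x + p) v vplus) \<and>
      (\<forall>vplus. newton_solver_output \<mu> f c \<beta> (x + p) v vplus \<longrightarrow>
         residual \<mu> f c (x + p) vplus = 0 \<and> (x + p, vplus) \<in> ball (xb, vb) r2)"
    if xv: "(x, v) \<in> ball (xb, vb) r3" "(x, v) \<in> stationary_set \<mu> f c" and p: "norm p \<le> r3" for x v p
  proof -
    interpret newton_neighbourhood "residual \<mu> f c (x + p)" "newton_map \<mu> f c (x + p)" vb m \<rho>
      by (rule nbhd)
    have dx: "norm (x - xb) < r3" and dv: "norm (v - vb) < r3"
      using xv(1) dist_fst_le[of "(xb, vb)" "(x, v)"] dist_snd_le[of "(xb, vb)" "(x, v)"]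
      by (simp_all add: dist_norm norm_minus_commute)
    have "residual \<mu> f c (x + p) v = - (0, 0, 0, 0, p)"
      using xv(2) shift[of "x + p" v x] by (simp add: stationary_set_def)
    then have "norm (residual \<mu> f c (x + p) v) = norm p" by (simp add: norm_Pair)
    then have "2 / m * norm (residual \<mu> f c (x + p) v) \<le> 2 / m * r3"
      using p m by (intro mult_left_mono) auto
    then have merit_le: "merit v < r3 + 2 / m * r3"
      using dv unfolding merit_def by linarith
    have r3_sum: "3 * r3 + 2 / m * r3 = min \<rho> r2" using r3(2) by (simp only: distrib_right)
    then have start: "merit v < \<rho>" using merit_le r3(1) by linarith
    have good: "\<exists>w. u \<longlonglongrightarrow> w \<and> residual \<mu> f c (x + p) w = 0 \<and> (x + p, w) \<in> ball (xb, vb) r2"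
      if u: "newton_run \<mu> f c (x + p) v (\<beta> (x + p) v) u" for u
    proof -
      have u0: "u 0 = v" and steps: "\<And>j. \<exists>\<Delta>. newton_map \<mu> f c (x + p) (u j) \<Delta>
          = - residual \<mu> f c (x + p) (u j) \<and> u (Suc j) = u j + \<beta> (x + p) v j *\<^sub>R \<Delta>"
        using u unfolding newton_run_def by blast+
      have "\<beta>min > 0" using assms(7) by simp
      then obtain w where w: "u \<longlonglongrightarrow> w" "residual \<mu> f c (x + p) w = 0" "norm (w - vb) \<le> merit v"
        using run_converges[OF C1_on_imp_continuous_on[OF C1] start[folded u0] assms(6) _ assms(8) steps]
        unfolding u0 by blast
      have "dist (xb, vb) (x + p, w) = norm (x + p - xb, w - vb)"
        by (simp add: dist_norm norm_Pair norm_minus_commute)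
      also have "\<dots> \<le> norm (x + p - xb) + norm (w - vb)" by (rule norm_Pair_le)
      also have "\<dots> < r2"
        using norm_triangle_ineq[of "x - xb" p] dx p w(3) merit_le r3_sum
        by (simp add: algebra_simps)
      finally have "(x + p, w) \<in> ball (xb, vb) r2" by (simp only: mem_ball)
      with w show ?thesis by blast
    qed
    obtain u where "newton_run \<mu> f c (x + p) v (\<beta> (x + p) v) u"
      using run_exists[of v "\<beta> (x + p) v"] start assms(6) unfolding newton_run_def by metis
    then show ?thesis
      using good unfolding newton_solver_output_def by (metis LIMSEQ_unique)
  qed
  have stationary_iff: "(x, v) \<in> stationary_set \<mu> f c \<longleftrightarrow> residual \<mu> f c x v = 0" for x v
    by (simp add: stationary_set_def)
  show ?thesis
  proof
    show "consistent_output \<mu> f c (newton_solver_output \<mu> f c \<beta>) r2 xb vb"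
      unfolding consistent_output_def using r3(1) key stationary_iff by blast
  qed (use r3(1) key in blast)
qed

end
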